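(* Let $A\in\mathbb M_n(\mathbb C)$ and let $\Omega\subset\mathbb C$ be an open set containing the spectrum $\sigma(A)$. Then the mapping $\varphi\mapsto\varphi(A)$ from $C^{n-1}(\overline\Omega)$ to $\mathbb M_n(\mathbb C)$ is a homomorphism; that is, for all $\varphi,\psi\in C^{n-1}(\overline\Omega)$ and $\alpha,\beta\in\mathbb C$, $$(\alpha\varphi+\beta\psi)(A)=\alpha\varphi(A)+\beta\psi(A),\qquad (\varphi\psi)(A)=\varphi(A)\psi(A).$$
   Context: $C^{k}(\overline\Omega)$ denotes complex-valued functions with continuous partial derivatives (in the real variables) up to order $k$ on $\overline\Omega$; products of functions are pointwise. With $\zeta=\xi+i\eta$, $\partial=\frac12\left(\frac{\partial}{\partial\xi}-i\frac{\partial}{\partial\eta}\right)$. Definition of $\varphi(A)$: let $m_A(z)=\prod_{j=1}^N(z-\lambda_j)^{1+n_j}$ (with distinct $\lambda_j$) be the minimal polynomial of $A$, and suppose $\varphi$ is $C^{n_j}$ in some closed disc of positive radius around $\lambda_j$, for each $j$. Let $p$ be the Hermite interpolation polynomial satisfying $p^{(\nu)}(\lambda_j)=\partial^\nu\varphi(\lambda_j)$ for $\nu=0,\dots,n_j$ and $j=1,\dots,N$. Then $\varphi(A):=p(A)$. *)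

theory Defs
  imports "HOL-Analysis.Derivative" "Jordan_Normal_Form.Spectral_Radius"
begin

section \<open>Functions with continuous partial derivatives up to the boundary\<close>

text \<open>
  \<^term>\<open>partial_deriv 1\<close> is the partial derivative in the real part of the argument,
  \<^term>\<open>partial_deriv \<i>\<close> the one in the imaginary part.
\<close>

definition partial_deriv :: "complex \<Rightarrow> (complex \<Rightarrow> complex) \<Rightarrow> complex \<Rightarrow> complex" where
  "partial_deriv e \<phi> z = vector_derivative (\<lambda>t::real. \<phi> (z + of_real t * e)) (at 0)"

definition has_partial_deriv :: "complex \<Rightarrow> (complex \<Rightarrow> complex) \<Rightarrow> complex \<Rightarrow> bool" where
  "has_partial_deriv e \<phi> z \<longleftrightarrow> (\<lambda>t::real. \<phi> (z + of_real t * e)) differentiable (at 0)"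

text \<open>
  All iterated partial derivatives up to order \<open>k\<close>, in every order of differentiation,
  exist on the open set \<open>\<Omega>\<close> and extend continuously to its closure.
\<close>

primrec Ck_interior :: "nat \<Rightarrow> complex set \<Rightarrow> (complex \<Rightarrow> complex) \<Rightarrow> bool" where
  "Ck_interior 0 \<Omega> \<phi> \<longleftrightarrow>
     (\<exists>g. continuous_on (closure \<Omega>) g \<and> (\<forall>z\<in>\<Omega>. g z = \<phi> z))"
| "Ck_interior (Suc k) \<Omega> \<phi> \<longleftrightarrow>
     (\<exists>g. continuous_on (closure \<Omega>) g \<and> (\<forall>z\<in>\<Omega>. g z = \<phi> z)) \<and>
     (\<forall>e\<in>{1, \<i>}. (\<forall>z\<in>\<Omega>. has_partial_deriv e \<phi> z) \<and> Ck_interior k \<Omega> (partial_deriv e \<phi>))"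

text \<open>
  The space of functions that are \<open>C\<^sup>k\<close> on the closure of the open set \<open>\<Omega>\<close>. Functions are
  total, so their values outside the closure are irrelevant; on the boundary, the values
  of the derivatives are those of their continuous extensions.
\<close>

definition Ck_closure :: "nat \<Rightarrow> complex set \<Rightarrow> (complex \<Rightarrow> complex) set" where
  "Ck_closure k \<Omega> = {\<phi>. continuous_on (closure \<Omega>) \<phi> \<and> Ck_interior k \<Omega> \<phi>}"

definition wirtinger :: "(complex \<Rightarrow> complex) \<Rightarrow> complex \<Rightarrow> complex" where
  "wirtinger \<phi> z = (1/2) * (partial_deriv 1 \<phi> z - \<i> * partial_deriv \<i> \<phi> z)"

section \<open>Functions of a matrix\<close>

text \<open>The matrix \<open>p(A)\<close>, the sum of the \<open>coeff p k \<cdot> A\<^sup>k\<close>, written entrywise.\<close>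

definition poly_mat :: "complex poly \<Rightarrow> complex mat \<Rightarrow> complex mat" where
  "poly_mat p A = mat (dim_row A) (dim_row A)
     (\<lambda>(i, j). \<Sum>k\<le>degree p. coeff p k * (A ^\<^sub>m k) $$ (i, j))"

definition annihilates :: "complex poly \<Rightarrow> complex mat \<Rightarrow> bool" where
  "annihilates p A \<longleftrightarrow> poly_mat p A = 0\<^sub>m (dim_row A) (dim_row A)"

definition min_poly :: "complex mat \<Rightarrow> complex poly" where
  "min_poly A = (THE p. lead_coeff p = 1 \<and> annihilates p A \<and>
     (\<forall>q. lead_coeff q = 1 \<and> annihilates q A \<longrightarrow> degree p \<le> degree q))"

text \<open>
  With \<open>n\<^sub>j + 1\<close> the multiplicity of the root \<open>\<mu>\<^sub>j\<close> of the minimal polynomial,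
  \<open>\<phi>(A)\<close> is defined when \<open>\<phi>\<close> has continuous derivatives up to order \<open>n\<^sub>j\<close> on some closed disc of positive
  radius around \<open>\<mu>\<^sub>j\<close>, for each \<open>j\<close>. Note that the closure of \<^term>\<open>ball \<mu> r\<close> is
  \<^term>\<open>cball \<mu> r\<close>.
\<close>

definition matrix_fun_defined :: "(complex \<Rightarrow> complex) \<Rightarrow> complex mat \<Rightarrow> bool" where
  "matrix_fun_defined \<phi> A \<longleftrightarrow>
     (\<forall>\<mu>. poly (min_poly A) \<mu> = 0 \<longrightarrow>
        (\<exists>r>0. \<phi> \<in> Ck_closure (Polynomial.order \<mu> (min_poly A) - 1) (ball \<mu> r)))"

text \<open>
  The Hermite interpolation polynomial is the unique solution of the interpolation
  conditions of degree less than the number of conditions, which is the degree of the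
  minimal polynomial. The condition \<open>\<nu> \<le> n\<^sub>j\<close> reads \<open>\<nu> < order \<mu>\<^sub>j\<close>.
\<close>

definition hermite_poly :: "(complex \<Rightarrow> complex) \<Rightarrow> complex mat \<Rightarrow> complex poly" where
  "hermite_poly \<phi> A = (THE p. degree p < degree (min_poly A) \<and>
     (\<forall>\<mu>. poly (min_poly A) \<mu> = 0 \<longrightarrow>
        (\<forall>\<nu> < Polynomial.order \<mu> (min_poly A).
           poly ((pderiv ^^ \<nu>) p) \<mu> = (wirtinger ^^ \<nu>) \<phi> \<mu>)))"

definition matrix_fun :: "(complex \<Rightarrow> complex) \<Rightarrow> complex mat \<Rightarrow> complex mat" where
  "matrix_fun \<phi> A = poly_mat (hermite_poly \<phi> A) A"

end

theory Submission
  imports Defs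
begin

text \<open>
  Modulo the minimal polynomial \<open>m\<close>, a polynomial is determined by its jets of order \<open>n\<^sub>j\<close> at the
  roots \<open>\<lambda>\<^sub>j\<close> of \<open>m\<close>, so \<open>\<phi>(A) = p(A)\<close> for every \<open>p\<close>, of any degree, whose jets agree with the
  Wirtinger jets of \<open>\<phi>\<close>. Since \<open>\<partial>\<close> is a derivation that restricts to the formal derivative on
  polynomials, the jets of \<open>\<alpha>\<phi> + \<beta>\<psi>\<close> and \<open>\<phi>\<psi>\<close> are those of \<open>\<alpha>p + \<beta>q\<close> and \<open>pq\<close>, and
  \<open>p \<mapsto> p(A)\<close> is a ring homomorphism. By Cayley--Hamilton, \<open>n\<^sub>j \<le> n - 1\<close>, so all
  the derivatives involved exist.
\<close>

section \<open>Polynomials in a matrix\<close>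

lemma poly_mat_carrier [simp]: "A \<in> carrier_mat n n \<Longrightarrow> poly_mat p A \<in> carrier_mat n n"
  by (auto simp: poly_mat_def)

lemma poly_mat_dim [simp]: "dim_row (poly_mat p A) = dim_row A" "dim_col (poly_mat p A) = dim_row A"
  by (auto simp: poly_mat_def)

text \<open>Coefficients beyond the degree vanish. A common bound \<open>N\<close> makes the sums
  for polynomials of different degrees comparable.\<close>

lemma poly_mat_index:
  assumes "A \<in> carrier_mat n n" "i < n" "j < n" "degree p \<le> N"
  shows "poly_mat p A $$ (i, j) = (\<Sum>k\<le>N. coeff p k * (A ^\<^sub>m k) $$ (i, j))"
proof -
  have "(\<Sum>k\<le>degree p. coeff p k * (A ^\<^sub>m k) $$ (i, j)) = (\<Sum>k\<le>N. coeff p k * (A ^\<^sub>m k) $$ (i, j))"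
    by (rule sum.mono_neutral_left) (use assms in \<open>auto intro: coeff_eq_0\<close>)
  then show ?thesis using assms by (auto simp: poly_mat_def)
qed

lemma poly_mat_0 [simp]: "A \<in> carrier_mat n n \<Longrightarrow> poly_mat 0 A = 0\<^sub>m n n"
  by (rule eq_matI) (auto simp: poly_mat_def)

lemma poly_mat_add:
  assumes A: "A \<in> carrier_mat n n"
  shows "poly_mat (p + q) A = poly_mat p A + poly_mat q A"
proof (rule eq_matI)
  fix i j assume "i < dim_row (poly_mat p A + poly_mat q A)" "j < dim_col (poly_mat p A + poly_mat q A)"
  then have ij: "i < n" "j < n" using A by auto
  let ?N = "max (degree p) (degree q)"
  have "degree (p + q) \<le> ?N" by (rule degree_add_le) auto
  then show "poly_mat (p + q) A $$ (i, j) = (poly_mat p A + poly_mat q A) $$ (i, j)"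
    using ij A by (simp add: poly_mat_index[OF A ij, of _ ?N] sum.distrib distrib_right)
qed (use A in auto)

lemma poly_mat_smult:
  assumes A: "A \<in> carrier_mat n n"
  shows "poly_mat (Polynomial.smult a p) A = a \<cdot>\<^sub>m poly_mat p A"
proof (rule eq_matI)
  fix i j assume "i < dim_row (a \<cdot>\<^sub>m poly_mat p A)" "j < dim_col (a \<cdot>\<^sub>m poly_mat p A)"
  then have ij: "i < n" "j < n" using A by auto
  have "degree (Polynomial.smult a p) \<le> degree p" by (rule degree_smult_le)
  then show "poly_mat (Polynomial.smult a p) A $$ (i, j) = (a \<cdot>\<^sub>m poly_mat p A) $$ (i, j)"
    using ij A by (simp add: poly_mat_index[OF A ij, of _ "degree p"] sum_distrib_left mult.assoc)
qed (use A in auto)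

text \<open>Horner's rule. The factor \<open>A\<close> stands on the right, as in the recursion of
  the matrix power.\<close>

lemma poly_mat_pCons:
  assumes A: "A \<in> carrier_mat n n"
  shows "poly_mat (pCons a p) A = a \<cdot>\<^sub>m 1\<^sub>m n + poly_mat p A * A"
proof (rule eq_matI)
  fix i j assume "i < dim_row (a \<cdot>\<^sub>m 1\<^sub>m n + poly_mat p A * A)" "j < dim_col (a \<cdot>\<^sub>m 1\<^sub>m n + poly_mat p A * A)"
  then have ij: "i < n" "j < n" using A by auto
  let ?N = "degree p"
  have pow: "A ^\<^sub>m k \<in> carrier_mat n n" for k using A by simp
  have step: "(A ^\<^sub>m Suc k) $$ (i, j) = (\<Sum>l<n. (A ^\<^sub>m k) $$ (i, l) * A $$ (l, j))" for k
    using A ij pow[of k] by (auto simp: scalar_prod_def atLeast0LessThan)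
  have "poly_mat (pCons a p) A $$ (i, j) = (\<Sum>k\<le>Suc ?N. coeff (pCons a p) k * (A ^\<^sub>m k) $$ (i, j))"
    by (rule poly_mat_index[OF A ij]) (rule degree_pCons_le)
  also have "\<dots> = a * (1\<^sub>m n) $$ (i, j) + (\<Sum>k\<le>?N. coeff p k * (A ^\<^sub>m Suc k) $$ (i, j))"
    using A by (subst sum.atMost_Suc_shift) simp
  also have "(\<Sum>k\<le>?N. coeff p k * (A ^\<^sub>m Suc k) $$ (i, j))
      = (\<Sum>l<n. (\<Sum>k\<le>?N. coeff p k * (A ^\<^sub>m k) $$ (i, l)) * A $$ (l, j))"
    unfolding step sum_distrib_left sum_distrib_right by (subst sum.swap) (simp add: mult.assoc)
  also have "\<dots> = (poly_mat p A * A) $$ (i, j)"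
    using A ij by (auto simp: scalar_prod_def atLeast0LessThan poly_mat_index[OF A ij(1) _ order_refl])
  finally show "poly_mat (pCons a p) A $$ (i, j) = (a \<cdot>\<^sub>m 1\<^sub>m n + poly_mat p A * A) $$ (i, j)"
    using A ij by simp
qed (use A in auto)

lemma poly_mat_linear:
  assumes A: "A \<in> carrier_mat n n"
  shows "poly_mat [:a, b:] A = a \<cdot>\<^sub>m 1\<^sub>m n + b \<cdot>\<^sub>m A"
proof -
  have "poly_mat [:b:] A * A = b \<cdot>\<^sub>m A"
    using A by (simp add: poly_mat_pCons[OF A] left_mult_zero_mat[of _ n n] mult_smult_assoc_mat[of _ n n])
  then show ?thesis by (simp add: poly_mat_pCons[OF A, of a])
qed

text \<open>Horner's rule for \<open>q\<close> puts every new factor \<open>A\<close> on the right,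
  so associativity and distributivity suffice.\<close>

lemma poly_mat_mult:
  assumes A: "A \<in> carrier_mat n n"
  shows "poly_mat (p * q) A = poly_mat p A * poly_mat q A"
proof (induction q)
  case 0
  show ?case using A by simp
next
  case (pCons a q)
  have P: "poly_mat p A \<in> carrier_mat n n" "poly_mat q A \<in> carrier_mat n n" using A by auto
  \<comment> \<open>Here \<open>p * pCons a q = smult a p + pCons 0 (p * q)\<close>; the zero
    multiple of the identity is the constant term of the second summand.\<close>
  have "poly_mat (p * pCons a q) A = a \<cdot>\<^sub>m poly_mat p A + (0 \<cdot>\<^sub>m 1\<^sub>m n + poly_mat p A * poly_mat q A * A)"
    using pCons by (simp add: mult_pCons_right poly_mat_add[OF A] poly_mat_smult[OF A] poly_mat_pCons[OF A])
  also have "0 \<cdot>\<^sub>m 1\<^sub>m n + poly_mat p A * poly_mat q A * A = poly_mat p A * (poly_mat q A * A)"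
  proof -
    have "0 \<cdot>\<^sub>m 1\<^sub>m n = (0\<^sub>m n n :: complex mat)" by (rule eq_matI) auto
    moreover have "poly_mat p A * poly_mat q A * A = poly_mat p A * (poly_mat q A * A)"
      by (rule assoc_mult_mat[OF P A])
    moreover have "0\<^sub>m n n + poly_mat p A * (poly_mat q A * A) = poly_mat p A * (poly_mat q A * A)"
      by (rule left_add_zero_mat) (use A P in auto)
    ultimately show ?thesis by (simp only:)
  qed
  also have "a \<cdot>\<^sub>m poly_mat p A = poly_mat p A * (a \<cdot>\<^sub>m 1\<^sub>m n)"
    using P by (simp add: mult_smult_distrib[OF P(1) one_carrier_mat] right_mult_one_mat[OF P(1)])
  also have "\<dots> + poly_mat p A * (poly_mat q A * A) = poly_mat p A * poly_mat (pCons a q) A"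
    unfolding poly_mat_pCons[OF A] by (rule mult_add_distrib_mat[symmetric]) (use A P in auto)
  finally show ?case .
qed

lemma poly_mat_eq_if_dvd_diff:
  assumes A: "A \<in> carrier_mat n n" and m: "annihilates m A" and "m dvd p - q"
  shows "poly_mat p A = poly_mat q A"
proof -
  obtain r where "p - q = m * r" using assms(3) by (elim dvdE)
  then have p: "p = q + m * r" by (simp add: algebra_simps)
  have "poly_mat m A = 0\<^sub>m n n" using m A by (simp add: annihilates_def)
  then show ?thesis
    using A by (simp add: p poly_mat_add[OF A] poly_mat_mult[OF A] left_mult_zero_mat[of _ n n])
qed

text \<open>
  With \<open>q \<bullet> v = q(A) v\<close>, the entries \<open>M\<close> of \<open>x I - A\<close> satisfy \<open>\<Sum>\<^sub>j M\<^sub>j\<^sub>i \<bullet> e\<^sub>j = 0\<close>;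
  multiplying by the adjugate gives \<open>det M \<bullet> e\<^sub>l = 0\<close>.
\<close>

theorem Cayley_Hamilton:
  assumes A: "A \<in> carrier_mat n n"
  shows "annihilates (char_poly A) A"
proof -
  define M where "M = char_poly_matrix A"
  define B where "B = adj_mat M"
  have M: "M \<in> carrier_mat n n" using A by (simp add: M_def)
  have B: "B \<in> carrier_mat n n" using adj_mat(1)[OF M] by (simp add: B_def)
  have MB: "M * B = char_poly A \<cdot>\<^sub>m 1\<^sub>m n" using adj_mat(2)[OF M] by (simp add: B_def M_def char_poly_def)
  have M_ind: "M $$ (j, i) = [: - (A $$ (j, i)), if i = j then 1 else 0 :]" if "i < n" "j < n" for i j
    using A that by (auto simp: M_def char_poly_matrix_def)
  have entry: "poly_mat [:a, b:] A $$ (i, j) = a * (if i = j then 1 else 0) + b * A $$ (i, j)"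
    if "i < n" "j < n" for a b i j
    using A that by (simp add: poly_mat_linear[OF A])
  \<comment> \<open>Entry \<open>s\<close> of the relation between the basis vectors: the constant
    coefficients sum to \<open>- A $$ (s, i)\<close> and the leading ones to
    \<open>A $$ (s, i)\<close>.\<close>
  have zero: "(\<Sum>j<n. poly_mat (M $$ (j, i)) A $$ (s, j)) = 0" if i: "i < n" and s: "s < n" for i s
  proof -
    have "(\<Sum>j<n. poly_mat (M $$ (j, i)) A $$ (s, j))
        = (\<Sum>j<n. (if j = s then - (A $$ (j, i)) else 0) + (if j = i then A $$ (s, j) else 0))"
      by (rule sum.cong) (use i s in \<open>auto simp: M_ind entry\<close>)
    also have "\<dots> = 0" using i s by (simp add: sum.distrib)
    finally show ?thesis .
  qed
  have sum_mat: "poly_mat (sum f S) A $$ (r, j) = (\<Sum>i\<in>S. poly_mat (f i) A $$ (r, j))"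
    if "finite S" "r < n" "j < n" for f :: "nat \<Rightarrow> complex poly" and S r j
    using that(1) by induction (use that A in \<open>auto simp: poly_mat_add[OF A]\<close>)
  have "poly_mat (char_poly A) A $$ (r, l) = 0" if r: "r < n" and l: "l < n" for r l
  proof -
    have prod: "poly_mat (B $$ (i, l) * M $$ (j, i)) A $$ (r, j)
        = (\<Sum>s<n. poly_mat (B $$ (i, l)) A $$ (r, s) * poly_mat (M $$ (j, i)) A $$ (s, j))"
      if "i < n" "j < n" for i j
      using A r that by (auto simp: poly_mat_mult[OF A] scalar_prod_def atLeast0LessThan)
    \<comment> \<open>The one-term sum brings in the Kronecker delta that turns
      \<open>char_poly A\<close> into the entry \<open>(j, l)\<close> of
      \<open>M * B\<close>.\<close>
    have "poly_mat (char_poly A) A $$ (r, l)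
        = (\<Sum>j<n. if j = l then poly_mat (char_poly A) A $$ (r, j) else 0)"
      using l by simp
    also have "\<dots> = (\<Sum>j<n. poly_mat ((M * B) $$ (j, l)) A $$ (r, j))"
      by (rule sum.cong) (use l r A in \<open>auto simp: MB\<close>)
    also have "\<dots> = (\<Sum>j<n. poly_mat (\<Sum>i<n. B $$ (i, l) * M $$ (j, i)) A $$ (r, j))"
      by (rule sum.cong) (use l M B in \<open>auto simp: scalar_prod_def atLeast0LessThan mult.commute\<close>)
    also have "\<dots> = (\<Sum>j<n. \<Sum>i<n. poly_mat (B $$ (i, l) * M $$ (j, i)) A $$ (r, j))"
      by (rule sum.cong) (use r in \<open>auto simp: sum_mat\<close>)
    also have "\<dots> = (\<Sum>i<n. \<Sum>j<n. \<Sum>s<n.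
        poly_mat (B $$ (i, l)) A $$ (r, s) * poly_mat (M $$ (j, i)) A $$ (s, j))"
      by (subst sum.swap) (simp add: prod)
    \<comment> \<open>With the sum over \<open>j\<close> innermost, the factor from the adjugate
      comes out and \<open>zero\<close> applies.\<close>
    also have "\<dots> = (\<Sum>i<n. \<Sum>s<n. poly_mat (B $$ (i, l)) A $$ (r, s) *
        (\<Sum>j<n. poly_mat (M $$ (j, i)) A $$ (s, j)))"
      unfolding sum_distrib_left by (intro sum.cong refl sum.swap)
    also have "\<dots> = 0" by (simp add: zero)
    finally show ?thesis .
  qed
  then have "poly_mat (char_poly A) A = 0\<^sub>m n n"
    using A by (intro eq_matI) auto
  then show ?thesis using A by (simp add: annihilates_def)
qed

section \<open>The minimal polynomial\<close>

text \<open>Cayley-Hamilton provides a monic annihilating polynomial, hence one of least degree. If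
  two differed, their leading terms would cancel in the difference, which, made monic, would
  annihilate \<open>A\<close> in smaller degree. This justifies the \<open>THE\<close> in
  \<open>min_poly\<close>.\<close>

lemma min_poly:
  assumes A: "A \<in> carrier_mat n n"
  shows lead_coeff_min_poly: "lead_coeff (min_poly A) = 1"
    and annihilates_min_poly: "annihilates (min_poly A) A"
    and degree_min_poly_le: "\<And>q. lead_coeff q = 1 \<Longrightarrow> annihilates q A \<Longrightarrow> degree (min_poly A) \<le> degree q"
proof -
  define P where "P p \<longleftrightarrow> lead_coeff p = 1 \<and> annihilates p A" for p
  have "P (char_poly A)"
    using Cayley_Hamilton[OF A] degree_monic_char_poly[OF A] by (simp add: P_def)
  then obtain p where p: "P p" "\<And>q. P q \<Longrightarrow> degree p \<le> degree q"
    using ex_has_least_nat[of P _ degree] by blast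
  have unique: "q = p" if q: "P q" "\<And>r. P r \<Longrightarrow> degree q \<le> degree r" for q
  proof (rule ccontr)
    assume "q \<noteq> p"
    define d where "d = q - p"
    define c where "c = inverse (lead_coeff d)"
    have deg: "degree q = degree p" using p q by (simp add: le_antisym)
    have "d \<noteq> 0" using \<open>q \<noteq> p\<close> by (simp add: d_def)
    have "coeff d (degree p) = 0"
      using p(1) q(1) deg by (simp add: d_def P_def)
    moreover have "degree d \<le> degree p" unfolding d_def by (rule degree_diff_le) (use deg in auto)
    ultimately have "degree d < degree p"
      using \<open>d \<noteq> 0\<close> leading_coeff_0_iff[of d] by (cases "degree d = degree p") auto
    moreover have "P (Polynomial.smult c d)"
    proof -
      have "poly_mat d A = poly_mat q A + (-1) \<cdot>\<^sub>m poly_mat p A"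
        using poly_mat_add[OF A, of q "Polynomial.smult (-1) p"] poly_mat_smult[OF A, of "-1" p]
        by (simp add: d_def)
      also have "\<dots> = 0\<^sub>m n n" using p(1) q(1) A by (auto simp: P_def annihilates_def)
      finally have "poly_mat d A = 0\<^sub>m n n" .
      then have "annihilates (Polynomial.smult c d) A"
        using A by (simp add: annihilates_def poly_mat_smult[OF A])
      then show ?thesis using \<open>d \<noteq> 0\<close> by (simp add: P_def c_def)
    qed
    then have "degree p \<le> degree (Polynomial.smult c d)" by (rule p)
    then have "degree p \<le> degree d" using degree_smult_le order_trans by blast
    ultimately show False by simp
  qed
  have "(THE p. P p \<and> (\<forall>q. P q \<longrightarrow> degree p \<le> degree q)) = p"
    by (rule the_equality) (use p unique in blast)+
  moreover have "min_poly A = (THE p. P p \<and> (\<forall>q. P q \<longrightarrow> degree p \<le> degree q))"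
    by (simp only: min_poly_def P_def conj_assoc)
  ultimately have "min_poly A = p" by (simp only:)
  then show "lead_coeff (min_poly A) = 1" "annihilates (min_poly A) A"
    "\<And>q. lead_coeff q = 1 \<Longrightarrow> annihilates q A \<Longrightarrow> degree (min_poly A) \<le> degree q"
    using p by (auto simp: P_def)
qed

lemma min_poly_nonzero: "A \<in> carrier_mat n n \<Longrightarrow> min_poly A \<noteq> 0"
  by (drule lead_coeff_min_poly) auto

lemma degree_min_poly_le_dim:
  assumes A: "A \<in> carrier_mat n n"
  shows "degree (min_poly A) \<le> n"
  using degree_min_poly_le[OF A _ Cayley_Hamilton[OF A]] degree_monic_char_poly[OF A] by simp

text \<open>A constant minimal polynomial would be 1, and the identity matrix of positive size would
  vanish.\<close>

lemma degree_min_poly_pos: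
  assumes A: "A \<in> carrier_mat n n" and "n \<ge> 1"
  shows "degree (min_poly A) > 0"
proof (rule ccontr)
  assume "\<not> degree (min_poly A) > 0"
  then have "degree (min_poly A) = 0" by simp
  then have "min_poly A = 1"
    using lead_coeff_min_poly[OF A] by (elim degree_eq_zeroE) (simp add: one_pCons)
  \<comment> \<open>The constant 1 is written as a linear polynomial to fit
    \<open>poly_mat_linear\<close>.\<close>
  then have "poly_mat [:1, 0:] A = 0\<^sub>m n n"
    using annihilates_min_poly[OF A] A by (simp add: annihilates_def one_pCons)
  then have "(1 \<cdot>\<^sub>m 1\<^sub>m n + 0 \<cdot>\<^sub>m A) $$ (0, 0) = 0"
    using \<open>n \<ge> 1\<close> unfolding poly_mat_linear[OF A] by simp
  then show False using A \<open>n \<ge> 1\<close> by simp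
qed

text \<open>If the minimal polynomial is \<open>[:-\<mu>, 1:] * q\<close>, then \<open>q(A)\<close>
  is nonzero by minimality, while \<open>A - \<mu>\<close> times \<open>q(A)\<close> is zero. A
  nonzero column of \<open>q(A)\<close> is therefore an eigenvector.\<close>

lemma min_poly_root_spectrum:
  assumes A: "A \<in> carrier_mat n n" and "poly (min_poly A) \<mu> = 0"
  shows "\<mu> \<in> spectrum A"
proof -
  obtain q where m: "min_poly A = [:-\<mu>, 1:] * q"
    using assms(2) unfolding poly_eq_0_iff_dvd by (elim dvdE)
  have "q \<noteq> 0" using m min_poly_nonzero[OF A] by auto
  have "lead_coeff q = 1" using lead_coeff_min_poly[OF A] by (simp add: m lead_coeff_mult del: mult_pCons_left)
  have "degree (min_poly A) = Suc (degree q)"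
    unfolding m using \<open>q \<noteq> 0\<close> by (subst degree_mult_eq) auto
  then have "\<not> annihilates q A"
    using degree_min_poly_le[OF A \<open>lead_coeff q = 1\<close>] by auto
  define Q where "Q = poly_mat q A"
  have Q: "Q \<in> carrier_mat n n" using A by (simp add: Q_def)
  have "Q \<noteq> 0\<^sub>m n n" using \<open>\<not> annihilates q A\<close> A by (simp add: annihilates_def Q_def)
  moreover have "Q = 0\<^sub>m n n" if "\<And>i j. i < n \<Longrightarrow> j < n \<Longrightarrow> Q $$ (i, j) = 0"
    using Q that by (intro eq_matI) auto
  ultimately obtain i j where ij: "i < n" "j < n" "Q $$ (i, j) \<noteq> 0" by blast
  have one_smult: "1 \<cdot>\<^sub>m A = A" using A by (intro eq_matI) auto
  have "0\<^sub>m n n = poly_mat [:-\<mu>, 1:] A * Q"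
    using annihilates_min_poly[OF A] A
    by (simp add: annihilates_def m poly_mat_mult[OF A] Q_def del: mult_pCons_left)
  also have "poly_mat [:-\<mu>, 1:] A = (-\<mu>) \<cdot>\<^sub>m 1\<^sub>m n + A"
    by (simp add: poly_mat_linear[OF A] one_smult)
  also have "\<dots> * Q = (-\<mu>) \<cdot>\<^sub>m Q + A * Q"
    using A Q by (simp add: add_mult_distrib_mat[of _ n n] mult_smult_assoc_mat[of _ n n])
  finally have AQ: "(-\<mu>) \<cdot>\<^sub>m Q + A * Q = 0\<^sub>m n n" ..
  have "eigenvector A (col Q j) \<mu>"
    unfolding eigenvector_def
  proof (intro conjI)
    show "col Q j \<in> carrier_vec (dim_row A)" using A Q by auto
    have "col Q j $ i \<noteq> 0" using ij Q by simp
    then show "col Q j \<noteq> 0\<^sub>v (dim_row A)" using ij A by auto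
    show "A *\<^sub>v col Q j = \<mu> \<cdot>\<^sub>v col Q j"
    proof (rule eq_vecI)
      fix r assume "r < dim_vec (\<mu> \<cdot>\<^sub>v col Q j)"
      then have r: "r < n" using Q by auto
      have "((-\<mu>) \<cdot>\<^sub>m Q + A * Q) $$ (r, j) = 0" using r ij by (simp add: AQ)
      then have "(A * Q) $$ (r, j) = \<mu> * Q $$ (r, j)" using A Q r ij by (simp add: algebra_simps)
      then show "(A *\<^sub>v col Q j) $ r = (\<mu> \<cdot>\<^sub>v col Q j) $ r" using A Q r ij by simp
    qed (use A Q in auto)
  qed
  then show ?thesis by (auto simp: spectrum_def eigenvalue_def)
qed

section \<open>Hermite interpolation\<close>

text \<open>In characteristic 0, differentiation lowers the order of a root by exactly one, which
  gives the induction step. For \<open>p = 0\<close> both sides hold, and for \<open>p\<close> not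
  vanishing at \<open>a\<close> both fail at exponent \<open>Suc k\<close>.\<close>

lemma linear_power_dvd_iff_higher_pderiv:
  fixes p :: "'a :: {idom, semiring_char_0} poly"
  shows "[:-a, 1:] ^ k dvd p \<longleftrightarrow> (\<forall>\<nu><k. poly ((pderiv ^^ \<nu>) p) a = 0)"
proof (induction k arbitrary: p)
  case 0
  show ?case by simp
next
  case (Suc k)
  show ?case
  proof (cases "p = 0 \<or> poly p a \<noteq> 0")
    case True
    then show ?thesis
      by (auto simp: order_divides order_eq_0_iff higher_pderiv_0 intro!: exI[of _ "0::nat"] dest: spec[of _ "0::nat"] order_0I)
  next
    case False
    \<comment> \<open>A nonzero polynomial with a root is not constant, so its derivative is
      nonzero, as \<open>order_pderiv\<close> requires.\<close>
    then have "degree p \<noteq> 0" by (metis degree_eq_zeroE pCons_0_0 poly_const_conv)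
    then have "pderiv p \<noteq> 0" by (simp add: pderiv_eq_0_iff)
    then have "[:-a, 1:] ^ Suc k dvd p \<longleftrightarrow> [:-a, 1:] ^ k dvd pderiv p"
      using False \<open>pderiv p \<noteq> 0\<close> order_pderiv[of p a] unfolding order_divides by simp
    also have "\<dots> \<longleftrightarrow> (\<forall>\<nu><k. poly ((pderiv ^^ Suc \<nu>) p) a = 0)"
      by (simp add: Suc.IH funpow_Suc_right del: funpow.simps)
    also have "\<dots> \<longleftrightarrow> (\<forall>\<nu><Suc k. poly ((pderiv ^^ \<nu>) p) a = 0)"
      using False by (simp add: All_less_Suc2 del: funpow.simps(2))
    finally show ?thesis .
  qed
qed

text \<open>Roots are split off one at a time until, by the fundamental theorem of algebra, a unit
  remains. In the step \<open>d = p * e\<close> by induction, and since \<open>p\<close> does not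
  vanish at \<open>x\<close>, the whole power of \<open>[:-x, 1:]\<close> divides
  \<open>e\<close>.\<close>

lemma dvd_if_root_powers_dvd:
  fixes m d :: "complex poly"
  assumes "m \<noteq> 0" and "\<And>\<mu>. [:-\<mu>, 1:] ^ Polynomial.order \<mu> m dvd d"
  shows "m dvd d"
  using assms
proof (induction m rule: poly_root_order_induct)
  case (no_roots p)
  then have "degree p = 0" using fundamental_theorem_of_algebra[of p] constant_degree[of p] by auto
  then have "is_unit p" using no_roots.prems(1) by (simp add: is_unit_iff_degree)
  then show ?case by (rule unit_imp_dvd)
next
  case (root p x k)
  have ord: "Polynomial.order \<mu> ([:-x, 1:] ^ k * p)
      = Polynomial.order \<mu> ([:-x, 1:] ^ k) + Polynomial.order \<mu> p" for \<mu>
    using root.prems(1) by (rule order_mult)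
  have "p \<noteq> 0" using root.prems(1) by auto
  moreover have "[:-\<mu>, 1:] ^ Polynomial.order \<mu> p dvd d" for \<mu>
    using root.prems(2)[of \<mu>] unfolding ord by (rule power_le_dvd) simp
  ultimately have "p dvd d" by (rule root.IH)
  then obtain e where d: "d = p * e" by (elim dvdE)
  have "[:-x, 1:] ^ k dvd d"
    using root.prems(2)[of x] unfolding ord order_power_n_n by (rule power_le_dvd) simp
  then have "d = 0 \<or> k \<le> Polynomial.order x p + Polynomial.order x e"
    unfolding order_divides d using order_mult[of p e x] by (cases "p * e = 0") simp_all
  then have "[:-x, 1:] ^ k dvd e"
    unfolding order_divides using root.hyps(2) \<open>p \<noteq> 0\<close> d order_0I[of p x] by simp
  then show ?case unfolding d by (subst mult.commute) (rule mult_dvd_mono[OF dvd_refl])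
qed auto

text \<open>Conditions are added one at a time. Passing from \<open>m'\<close> to
  \<open>[:-a, 1:] * m'\<close> adds just the condition of order \<open>k\<close> at
  \<open>a\<close>. Adding a multiple of \<open>m'\<close> to \<open>p\<close> preserves the old
  conditions and can meet the new one.\<close>

lemma hermite_interpolation_exists:
  fixes m :: "complex poly"
  assumes "m \<noteq> 0"
  shows "\<exists>p. \<forall>\<mu>. \<forall>\<nu><Polynomial.order \<mu> m. poly ((pderiv ^^ \<nu>) p) \<mu> = c \<mu> \<nu>"
  using assms
proof (induction "degree m" arbitrary: m)
  case 0
  then have "Polynomial.order \<mu> m = 0" for \<mu> using order_degree[of m \<mu>] by simp
  then show ?case by simp
next
  case (Suc d)
  then obtain a where "poly m a = 0"
    using fundamental_theorem_of_algebra constant_degree by (metis nat.distinct(1))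
  then obtain m' where m: "m = [:-a, 1:] * m'" unfolding poly_eq_0_iff_dvd by (elim dvdE)
  have "m' \<noteq> 0" using m Suc.prems by auto
  have "degree m = Suc (degree m')" unfolding m using \<open>m' \<noteq> 0\<close> by (subst degree_mult_eq) auto
  then obtain p where p: "\<And>\<mu> \<nu>. \<nu> < Polynomial.order \<mu> m' \<Longrightarrow> poly ((pderiv ^^ \<nu>) p) \<mu> = c \<mu> \<nu>"
    using Suc.hyps(1)[of m'] Suc.hyps(2) \<open>m' \<noteq> 0\<close> by auto
  define k where "k = Polynomial.order a m'"
  have van: "poly ((pderiv ^^ \<nu>) m') \<mu> = 0" if "\<nu> < Polynomial.order \<mu> m'" for \<mu> \<nu>
    using that order_1[of \<mu> m'] by (simp add: linear_power_dvd_iff_higher_pderiv)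
  \<comment> \<open>Since \<open>k\<close> is the exact order of \<open>a\<close> in
    \<open>m'\<close>, the derivative of order \<open>k\<close> is the first that does not vanish
    there.\<close>
  have nz: "poly ((pderiv ^^ k) m') a \<noteq> 0"
    using order_2[OF \<open>m' \<noteq> 0\<close>, of a] van[of _ a]
    unfolding linear_power_dvd_iff_higher_pderiv k_def by (auto simp: less_Suc_eq)
  have "Polynomial.order \<mu> m = Polynomial.order \<mu> [:-a, 1:] + Polynomial.order \<mu> m'" for \<mu>
    using Suc.prems unfolding m by (rule order_mult)
  moreover have "Polynomial.order \<mu> [:-a, 1:] = (if \<mu> = a then 1 else 0)" for \<mu>
    using order_power_n_n[of a 1] by (auto intro: order_0I)
  ultimately have ord: "Polynomial.order \<mu> m = (if \<mu> = a then Suc k else Polynomial.order \<mu> m')" for \<mu>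
    by (simp add: k_def)
  \<comment> \<open>\<open>t\<close> solves the new condition, which is linear in the coefficient of
    \<open>m'\<close>.\<close>
  define t where "t = (c a k - poly ((pderiv ^^ k) p) a) / poly ((pderiv ^^ k) m') a"
  have "poly ((pderiv ^^ \<nu>) (p + Polynomial.smult t m')) \<mu> = c \<mu> \<nu>" if "\<nu> < Polynomial.order \<mu> m" for \<mu> \<nu>
  proof (cases "\<nu> < Polynomial.order \<mu> m'")
    case True
    then show ?thesis by (simp add: higher_pderiv_add higher_pderiv_smult p van)
  next
    case False
    then have "\<mu> = a" "\<nu> = k" using that by (auto simp: ord k_def split: if_splits)
    then show ?thesis using nz by (simp add: higher_pderiv_add higher_pderiv_smult t_def)
  qed
  then show ?case by blast
qed

text \<open>The solutions of the interpolation conditions form the residue class of \<open>p\<close>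
  modulo the minimal polynomial. The remainder of \<open>p\<close> is its only member of small
  degree, so it is \<open>hermite_poly \<phi> A\<close>.\<close>

lemma matrix_fun_eq_poly_mat:
  assumes A: "A \<in> carrier_mat n n" and "n \<ge> 1"
    and p: "\<And>\<mu> \<nu>. poly (min_poly A) \<mu> = 0 \<Longrightarrow> \<nu> < Polynomial.order \<mu> (min_poly A) \<Longrightarrow>
           poly ((pderiv ^^ \<nu>) p) \<mu> = (wirtinger ^^ \<nu>) \<phi> \<mu>"
  shows "matrix_fun \<phi> A = poly_mat p A"
proof -
  let ?m = "min_poly A"
  define H where "H q \<longleftrightarrow> (\<forall>\<mu>. poly ?m \<mu> = 0 \<longrightarrow> (\<forall>\<nu> < Polynomial.order \<mu> ?m.
           poly ((pderiv ^^ \<nu>) q) \<mu> = (wirtinger ^^ \<nu>) \<phi> \<mu>))" for q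
  have m0: "?m \<noteq> 0" using min_poly_nonzero[OF A] .
  \<comment> \<open>Away from the roots the order is 0 and there are no conditions, so
    \<open>\<mu>\<close> may range over all complex numbers.\<close>
  have root: "poly ?m \<mu> = 0" if "\<nu> < Polynomial.order \<mu> ?m" for \<mu> \<nu>
    using that order_0I[of ?m \<mu>] by (cases "poly ?m \<mu> = 0") simp_all
  have dvd_iff: "?m dvd q - r \<longleftrightarrow>
      (\<forall>\<mu>. \<forall>\<nu> < Polynomial.order \<mu> ?m. poly ((pderiv ^^ \<nu>) q) \<mu> = poly ((pderiv ^^ \<nu>) r) \<mu>)" for q r
  proof -
    have "?m dvd q - r \<longleftrightarrow> (\<forall>\<mu>. [:-\<mu>, 1:] ^ Polynomial.order \<mu> ?m dvd q - r)"
      by (meson dvd_if_root_powers_dvd[OF m0] order_1 dvd_trans)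
    moreover have "(pderiv ^^ \<nu>) (q - r) = (pderiv ^^ \<nu>) q - (pderiv ^^ \<nu>) r" for \<nu>
      by (induction \<nu>) (simp_all add: pderiv_diff)
    ultimately show ?thesis by (simp add: linear_power_dvd_iff_higher_pderiv)
  qed
  have H_iff: "H q \<longleftrightarrow> ?m dvd q - p" for q
    unfolding dvd_iff H_def
  proof (intro iffI allI impI)
    fix \<mu> \<nu> assume \<nu>: "\<nu> < Polynomial.order \<mu> ?m"
    assume "\<forall>\<mu>. poly ?m \<mu> = 0 \<longrightarrow> (\<forall>\<nu> < Polynomial.order \<mu> ?m.
           poly ((pderiv ^^ \<nu>) q) \<mu> = (wirtinger ^^ \<nu>) \<phi> \<mu>)"
    then show "poly ((pderiv ^^ \<nu>) q) \<mu> = poly ((pderiv ^^ \<nu>) p) \<mu>"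
      using p[OF root[OF \<nu>] \<nu>] root[OF \<nu>] \<nu> by simp
  qed (simp add: p)
  define h where "h = p mod ?m"
  \<comment> \<open>A zero remainder has degree 0, so the strict inequality relies on the positive
    degree of the minimal polynomial.\<close>
  have deg: "degree h < degree ?m"
    using degree_mod_less[OF m0, of p] degree_min_poly_pos[OF A \<open>n \<ge> 1\<close>] by (auto simp: h_def)
  have "H h"
    unfolding H_iff h_def by (subst dvd_diff_commute) (rule dvd_minus_mod)
  have unique: "q = h" if "degree q < degree ?m" "H q" for q
  proof (rule ccontr)
    assume "q \<noteq> h"
    have "?m dvd (q - p) - (h - p)" using that(2) \<open>H h\<close> unfolding H_iff by (rule dvd_diff)
    then have "degree ?m \<le> degree (q - h)" using \<open>q \<noteq> h\<close> by (intro dvd_imp_degree_le) auto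
    moreover have "degree (q - h) < degree ?m" using that(1) deg by (rule degree_diff_less)
    ultimately show False by simp
  qed
  have "(THE q. degree q < degree ?m \<and> H q) = h"
    by (rule the_equality) (use deg \<open>H h\<close> unique in blast)+
  then have "hermite_poly \<phi> A = h"
    unfolding hermite_poly_def H_def .
  moreover have "poly_mat h A = poly_mat p A"
    using \<open>H h\<close> unfolding H_iff by (rule poly_mat_eq_if_dvd_diff[OF A annihilates_min_poly[OF A]])
  ultimately show ?thesis by (simp add: matrix_fun_def)
qed

section \<open>The algebra of continuously differentiable functions\<close>

text \<open>Thus an identity on \<open>\<Omega>\<close> holds along the line for all parameters near
  0, enough to compare derivatives at 0.\<close>

lemma open_line_preimage:
  fixes e z :: complex
  assumes "open \<Omega>"
  shows "open {t::real. z + of_real t * e \<in> \<Omega>}"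
proof -
  have "open ((\<lambda>t::real. z + of_real t * e) -` \<Omega>)"
    by (intro open_vimage assms continuous_intros)
  then show ?thesis by (simp add: vimage_def)
qed

lemma has_partial_derivI:
  assumes "((\<lambda>t::real. f (z + of_real t * e)) has_vector_derivative D) (at 0)"
  shows "has_partial_deriv e f z" "partial_deriv e f z = D"
  using assms by (auto simp: has_partial_deriv_def partial_deriv_def vector_derivative_at differentiableI_vector)

lemma has_partial_derivD:
  assumes "has_partial_deriv e f z"
  shows "((\<lambda>t::real. f (z + of_real t * e)) has_vector_derivative partial_deriv e f z) (at 0)"
  using assms by (simp add: has_partial_deriv_def partial_deriv_def vector_derivative_works)

lemma partial_deriv_cong:
  assumes "open \<Omega>" "z \<in> \<Omega>" "\<And>w. w \<in> \<Omega> \<Longrightarrow> f w = g w"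
  shows "partial_deriv e f z = partial_deriv e g z"
proof -
  have "eventually (\<lambda>t::real. f (z + of_real t * e) = g (z + of_real t * e)) (nhds 0)"
    using open_line_preimage[OF assms(1), of z e] assms(2,3) by (auto simp: eventually_nhds)
  then show ?thesis
    unfolding partial_deriv_def by (intro vector_derivative_cong_eq) auto
qed

lemma has_partial_deriv_cong:
  assumes "open \<Omega>" "z \<in> \<Omega>" "\<And>w. w \<in> \<Omega> \<Longrightarrow> f w = g w" "has_partial_deriv e f z"
  shows "has_partial_deriv e g z"
proof -
  have "open {t::real. z + of_real t * e \<in> \<Omega>}"
    using open_line_preimage[OF assms(1)] .
  then have "((\<lambda>t::real. g (z + of_real t * e)) has_vector_derivative partial_deriv e f z) (at 0)"
    by (rule has_vector_derivative_transform_within_open[OF has_partial_derivD[OF assms(4)]])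
      (use assms(2,3) in auto)
  then show ?thesis by (rule has_partial_derivI)
qed

lemma partial_deriv_lincomb:
  assumes "has_partial_deriv e f z" "has_partial_deriv e g z"
  shows "has_partial_deriv e (\<lambda>w. \<alpha> * f w + \<beta> * g w) z"
    and "partial_deriv e (\<lambda>w. \<alpha> * f w + \<beta> * g w) z = \<alpha> * partial_deriv e f z + \<beta> * partial_deriv e g z"
proof -
  have "((\<lambda>t::real. \<alpha> * f (z + of_real t * e) + \<beta> * g (z + of_real t * e)) has_vector_derivative
      \<alpha> * partial_deriv e f z + \<beta> * partial_deriv e g z) (at 0)"
    by (intro has_vector_derivative_add has_vector_derivative_mult_right has_partial_derivD assms)
  from has_partial_derivI[OF this] show "has_partial_deriv e (\<lambda>w. \<alpha> * f w + \<beta> * g w) z"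
    "partial_deriv e (\<lambda>w. \<alpha> * f w + \<beta> * g w) z = \<alpha> * partial_deriv e f z + \<beta> * partial_deriv e g z" by auto
qed

lemma partial_deriv_mult:
  assumes "has_partial_deriv e f z" "has_partial_deriv e g z"
  shows "has_partial_deriv e (\<lambda>w. f w * g w) z"
    and "partial_deriv e (\<lambda>w. f w * g w) z = f z * partial_deriv e g z + partial_deriv e f z * g z"
proof -
  have "((\<lambda>t::real. f (z + of_real t * e) * g (z + of_real t * e)) has_vector_derivative
      f z * partial_deriv e g z + partial_deriv e f z * g z) (at 0)"
    using has_vector_derivative_mult[OF has_partial_derivD[OF assms(1)] has_partial_derivD[OF assms(2)]] by simp
  from has_partial_derivI[OF this] show "has_partial_deriv e (\<lambda>w. f w * g w) z"
    "partial_deriv e (\<lambda>w. f w * g w) z = f z * partial_deriv e g z + partial_deriv e f z * g z" by auto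
qed

lemma partial_deriv_poly:
  "has_partial_deriv e (poly p) z" "partial_deriv e (poly p) z = e * poly (pderiv p) z"
proof -
  have "((\<lambda>t::real. z + of_real t * e) has_vector_derivative e) (at 0)"
    by (auto intro!: derivative_eq_intros simp: has_vector_derivative_def scaleR_conv_of_real)
  moreover have "(poly p has_field_derivative poly (pderiv p) z) (at (z + of_real 0 * e))"
    by (simp add: poly_DERIV)
  ultimately have "((\<lambda>t::real. poly p (z + of_real t * e)) has_vector_derivative e * poly (pderiv p) z) (at 0)"
    using field_vector_diff_chain_at by (fastforce simp: o_def)
  from has_partial_derivI[OF this] show "has_partial_deriv e (poly p) z"
    "partial_deriv e (poly p) z = e * poly (pderiv p) z" by auto
qed

text \<open>The rules for derivatives hold only on \<open>\<Omega>\<close>, not as equations between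
  total functions; this lemma allows a derivative to be replaced by its formula.\<close>

lemma Ck_interior_cong:
  assumes "open \<Omega>" "\<And>z. z \<in> \<Omega> \<Longrightarrow> f z = g z" "Ck_interior k \<Omega> f"
  shows "Ck_interior k \<Omega> g"
  using assms(2,3)
proof (induction k arbitrary: f g)
  case 0
  then show ?case by auto
next
  case (Suc k)
  have "Ck_interior k \<Omega> (partial_deriv e g)" if "e \<in> {1, \<i>}" for e
    by (rule Suc.IH[of "partial_deriv e f"], rule partial_deriv_cong[OF assms(1)])
      (use Suc.prems that in auto)
  moreover have "has_partial_deriv e g z" if "e \<in> {1, \<i>}" "z \<in> \<Omega>" for e z
    by (rule has_partial_deriv_cong[OF assms(1), of z f]) (use Suc.prems that in auto)
  ultimately show ?case using Suc.prems by simp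
qed

lemma Ck_interior_SucD: "Ck_interior (Suc k) \<Omega> f \<Longrightarrow> Ck_interior k \<Omega> f"
proof (induction k arbitrary: f)
  case (Suc k)
  have "Ck_interior k \<Omega> (partial_deriv e f)" if "e \<in> {1, \<i>}" for e
    by (rule Suc.IH) (use Suc.prems that in \<open>simp only: Ck_interior.simps(2)[of "Suc k"]\<close>)
  then show ?case using Suc.prems by simp
qed simp

lemma Ck_interior_le:
  assumes "Ck_interior k \<Omega> f" "j \<le> k"
  shows "Ck_interior j \<Omega> f"
  using assms(2,1) by (induction rule: inc_induct) (auto dest: Ck_interior_SucD simp del: Ck_interior.simps)

lemma Ck_interior_subset:
  assumes "Ck_interior k \<Omega> f" "S \<subseteq> \<Omega>"
  shows "Ck_interior k S f"
proof -
  have "\<exists>g. continuous_on (closure S) g \<and> (\<forall>z\<in>S. g z = f z)"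
    if "\<exists>g. continuous_on (closure \<Omega>) g \<and> (\<forall>z\<in>\<Omega>. g z = f z)" for f :: "complex \<Rightarrow> complex"
    using that assms(2) continuous_on_subset[OF _ closure_mono[OF assms(2)]] by blast
  then show ?thesis using assms
    by (induction k arbitrary: f) (simp_all add: subset_iff)
qed

lemma Ck_interior_lincomb:
  assumes "open \<Omega>" "Ck_interior k \<Omega> f" "Ck_interior k \<Omega> g"
  shows "Ck_interior k \<Omega> (\<lambda>z. \<alpha> * f z + \<beta> * g z)"
proof -
  have ext: "\<exists>h. continuous_on (closure \<Omega>) h \<and> (\<forall>z\<in>\<Omega>. h z = \<alpha> * f z + \<beta> * g z)"
    if f: "\<exists>h. continuous_on (closure \<Omega>) h \<and> (\<forall>z\<in>\<Omega>. h z = f z)"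
      and g: "\<exists>h. continuous_on (closure \<Omega>) h \<and> (\<forall>z\<in>\<Omega>. h z = g z)" for f g :: "complex \<Rightarrow> complex"
  proof -
    obtain h1 where "continuous_on (closure \<Omega>) h1" "\<forall>z\<in>\<Omega>. h1 z = f z" using f by auto
    moreover obtain h2 where "continuous_on (closure \<Omega>) h2" "\<forall>z\<in>\<Omega>. h2 z = g z" using g by auto
    ultimately show ?thesis
      by (intro exI[of _ "\<lambda>z. \<alpha> * h1 z + \<beta> * h2 z"]) (auto intro!: continuous_intros)
  qed
  show ?thesis using assms(2,3)
  proof (induction k arbitrary: f g)
    case 0
    then show ?case using ext[of f g] by simp
  next
    case (Suc k)
    have "Ck_interior k \<Omega> (partial_deriv e (\<lambda>z. \<alpha> * f z + \<beta> * g z))" if e: "e \<in> {1, \<i>}" for e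
      by (rule Ck_interior_cong[OF assms(1) _ Suc.IH[of "partial_deriv e f" "partial_deriv e g"]])
        (use Suc.prems e in \<open>auto simp: partial_deriv_lincomb\<close>)
    then show ?case using Suc.prems ext[of f g] by (auto intro: partial_deriv_lincomb(1))
  qed
qed

text \<open>By the product rule each partial derivative is a sum of two products. Their factors lie
  in class \<open>k\<close>, once the undifferentiated one is lowered from
  \<open>Suc k\<close>.\<close>

lemma Ck_interior_mult:
  assumes "open \<Omega>" "Ck_interior k \<Omega> f" "Ck_interior k \<Omega> g"
  shows "Ck_interior k \<Omega> (\<lambda>z. f z * g z)"
proof -
  have ext: "\<exists>h. continuous_on (closure \<Omega>) h \<and> (\<forall>z\<in>\<Omega>. h z = f z * g z)"
    if f: "\<exists>h. continuous_on (closure \<Omega>) h \<and> (\<forall>z\<in>\<Omega>. h z = f z)"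
      and g: "\<exists>h. continuous_on (closure \<Omega>) h \<and> (\<forall>z\<in>\<Omega>. h z = g z)" for f g :: "complex \<Rightarrow> complex"
  proof -
    obtain h1 where "continuous_on (closure \<Omega>) h1" "\<forall>z\<in>\<Omega>. h1 z = f z" using f by auto
    moreover obtain h2 where "continuous_on (closure \<Omega>) h2" "\<forall>z\<in>\<Omega>. h2 z = g z" using g by auto
    ultimately show ?thesis
      by (intro exI[of _ "\<lambda>z. h1 z * h2 z"]) (auto intro!: continuous_intros)
  qed
  show ?thesis using assms(2,3)
  proof (induction k arbitrary: f g)
    case 0
    then show ?case using ext[of f g] by simp
  next
    case (Suc k)
    note lower = Suc.prems[THEN Ck_interior_SucD]
    have "Ck_interior k \<Omega> (partial_deriv e (\<lambda>z. f z * g z))" if e: "e \<in> {1, \<i>}" for e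
    proof (rule Ck_interior_cong[OF assms(1)])
      \<comment> \<open>The coefficients 1 give the sum the shape required by
        \<open>Ck_interior_lincomb\<close>.\<close>
      show "Ck_interior k \<Omega> (\<lambda>z. 1 * (f z * partial_deriv e g z) + 1 * (partial_deriv e f z * g z))"
        by (intro Ck_interior_lincomb[OF assms(1)] Suc.IH lower) (use Suc.prems e in auto)
    qed (use Suc.prems e in \<open>auto simp: partial_deriv_mult\<close>)
    then show ?case using Suc.prems ext[of f g] by (auto intro: partial_deriv_mult(1))
  qed
qed

lemma Ck_interior_poly: "Ck_interior k \<Omega> (poly p)"
proof (induction k arbitrary: p)
  case 0
  have "continuous_on (closure \<Omega>) (poly p)" by (rule continuous_on_poly[OF continuous_on_id])
  then show ?case by auto
next
  case (Suc k)
  have "partial_deriv e (poly p) = poly (Polynomial.smult e (pderiv p))" for e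
    by (rule ext) (simp add: partial_deriv_poly)
  then show ?case
    using Suc continuous_on_poly[OF continuous_on_id, of "closure \<Omega>" p] by (auto simp: partial_deriv_poly(1))
qed

lemma Ck_closure_lincomb:
  "open \<Omega> \<Longrightarrow> f \<in> Ck_closure k \<Omega> \<Longrightarrow> g \<in> Ck_closure k \<Omega> \<Longrightarrow> (\<lambda>z. \<alpha> * f z + \<beta> * g z) \<in> Ck_closure k \<Omega>"
  by (simp add: Ck_closure_def Ck_interior_lincomb continuous_on_add continuous_on_mult_left)

lemma Ck_closure_mult:
  "open \<Omega> \<Longrightarrow> f \<in> Ck_closure k \<Omega> \<Longrightarrow> g \<in> Ck_closure k \<Omega> \<Longrightarrow> (\<lambda>z. f z * g z) \<in> Ck_closure k \<Omega>"
  by (simp add: Ck_closure_def Ck_interior_mult continuous_on_mult)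

section \<open>Jets of Wirtinger derivatives\<close>

text \<open>The directions 1 and \<open>\<i>\<close> contribute the factors 1 and
  \<open>\<i>\<close>, and \<open>(1 - \<i> * \<i>) / 2 = 1\<close>.\<close>

lemma wirtinger_poly: "wirtinger (poly p) = poly (pderiv p)"
  by (rule ext) (simp add: wirtinger_def partial_deriv_poly flip: mult.assoc)

lemma wirtinger_funpow_poly: "(wirtinger ^^ \<nu>) (poly p) = poly ((pderiv ^^ \<nu>) p)"
  by (induction \<nu>) (simp_all add: wirtinger_poly)

lemma wirtinger_funpow_cong:
  assumes "open \<Omega>" "z \<in> \<Omega>" "\<And>w. w \<in> \<Omega> \<Longrightarrow> f w = g w"
  shows "(wirtinger ^^ \<nu>) f z = (wirtinger ^^ \<nu>) g z"
  using assms(2,3)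
proof (induction \<nu> arbitrary: z)
  case (Suc \<nu>)
  then have "partial_deriv e ((wirtinger ^^ \<nu>) f) z = partial_deriv e ((wirtinger ^^ \<nu>) g) z" for e
    by (intro partial_deriv_cong[OF assms(1)]) auto
  then show ?case
    by (simp add: wirtinger_def[of "(wirtinger ^^ \<nu>) f"] wirtinger_def[of "(wirtinger ^^ \<nu>) g"])
qed simp

lemma Ck_interior_wirtinger:
  assumes "open \<Omega>" "Ck_interior (Suc k) \<Omega> f"
  shows "Ck_interior k \<Omega> (wirtinger f)"
proof -
  have "Ck_interior k \<Omega> (\<lambda>z. (1/2) * partial_deriv 1 f z + (-\<i>/2) * partial_deriv \<i> f z)"
    using assms by (intro Ck_interior_lincomb) auto
  then show ?thesis
    by (rule Ck_interior_cong[OF assms(1), rotated]) (simp add: wirtinger_def algebra_simps)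
qed

lemma wirtinger_lincomb:
  assumes "Ck_interior (Suc k) \<Omega> f" "Ck_interior (Suc k) \<Omega> g" "z \<in> \<Omega>"
  shows "wirtinger (\<lambda>z. \<alpha> * f z + \<beta> * g z) z = \<alpha> * wirtinger f z + \<beta> * wirtinger g z"
  using assms by (simp add: wirtinger_def partial_deriv_lincomb algebra_simps)

lemma wirtinger_mult:
  assumes "Ck_interior (Suc k) \<Omega> f" "Ck_interior (Suc k) \<Omega> g" "z \<in> \<Omega>"
  shows "wirtinger (\<lambda>z. f z * g z) z = f z * wirtinger g z + wirtinger f z * g z"
  using assms by (simp add: wirtinger_def partial_deriv_mult algebra_simps)

lemma wirtinger_funpow_lincomb:
  assumes "open \<Omega>" "Ck_interior \<nu> \<Omega> f" "Ck_interior \<nu> \<Omega> g" "z \<in> \<Omega>"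
  shows "(wirtinger ^^ \<nu>) (\<lambda>z. \<alpha> * f z + \<beta> * g z) z
    = \<alpha> * (wirtinger ^^ \<nu>) f z + \<beta> * (wirtinger ^^ \<nu>) g z"
  using assms(2,3)
proof (induction \<nu> arbitrary: f g)
  case (Suc \<nu>)
  have "(wirtinger ^^ Suc \<nu>) (\<lambda>z. \<alpha> * f z + \<beta> * g z) z
      = (wirtinger ^^ \<nu>) (\<lambda>z. \<alpha> * wirtinger f z + \<beta> * wirtinger g z) z"
    \<comment> \<open>Peeling off the innermost operator leaves \<open>wirtinger f\<close> and
      \<open>wirtinger g\<close>, one class lower, for the induction hypothesis.\<close>
    unfolding funpow_Suc_right o_def
    by (rule wirtinger_funpow_cong[OF assms(1,4)]) (rule wirtinger_lincomb[OF Suc.prems])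
  also have "\<dots> = \<alpha> * (wirtinger ^^ Suc \<nu>) f z + \<beta> * (wirtinger ^^ Suc \<nu>) g z"
    unfolding funpow_Suc_right o_def
    by (rule Suc.IH) (use Suc.prems assms(1) in \<open>auto intro!: Ck_interior_wirtinger simp del: Ck_interior.simps\<close>)
  finally show ?case .
qed simp

text \<open>The jet of a product depends only on the jets of its factors. Comparing two pairs of
  factors avoids the binomial form of the Leibniz rule: one product rule yields two products whose
  factors again have matching jets of order \<open>k\<close>.\<close>

lemma wirtinger_jet_mult:
  assumes "open \<Omega>" "z \<in> \<Omega>"
    and "Ck_interior k \<Omega> f" "Ck_interior k \<Omega> g" "Ck_interior k \<Omega> f'" "Ck_interior k \<Omega> g'"
    and "\<And>i. i \<le> k \<Longrightarrow> (wirtinger ^^ i) f z = (wirtinger ^^ i) f' z"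
    and "\<And>i. i \<le> k \<Longrightarrow> (wirtinger ^^ i) g z = (wirtinger ^^ i) g' z"
  shows "(wirtinger ^^ k) (\<lambda>w. f w * g w) z = (wirtinger ^^ k) (\<lambda>w. f' w * g' w) z"
  using assms(3-)
proof (induction k arbitrary: f g f' g')
  case 0
  then show ?case by simp
next
  case (Suc k)
  have lower: "Ck_interior k \<Omega> f" "Ck_interior k \<Omega> g" "Ck_interior k \<Omega> f'" "Ck_interior k \<Omega> g'"
    using Suc.prems(1-4) by (simp_all only: Ck_interior_SucD)
  have expand: "(wirtinger ^^ Suc k) (\<lambda>w. u w * v w) z
      = 1 * (wirtinger ^^ k) (\<lambda>w. u w * wirtinger v w) z + 1 * (wirtinger ^^ k) (\<lambda>w. wirtinger u w * v w) z"
    if u: "Ck_interior (Suc k) \<Omega> u" and v: "Ck_interior (Suc k) \<Omega> v" for u v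
  proof -
    have "(wirtinger ^^ Suc k) (\<lambda>w. u w * v w) z
        = (wirtinger ^^ k) (\<lambda>w. 1 * (u w * wirtinger v w) + 1 * (wirtinger u w * v w)) z"
      unfolding funpow_Suc_right o_def
      by (rule wirtinger_funpow_cong[OF assms(1,2)]) (simp add: wirtinger_mult[OF u v])
    also have "\<dots> = 1 * (wirtinger ^^ k) (\<lambda>w. u w * wirtinger v w) z
        + 1 * (wirtinger ^^ k) (\<lambda>w. wirtinger u w * v w) z"
      by (intro wirtinger_funpow_lincomb[OF assms(1) _ _ assms(2)] Ck_interior_mult[OF assms(1)]
          Ck_interior_wirtinger[OF assms(1)] Ck_interior_SucD[OF u] Ck_interior_SucD[OF v] u v)
    finally show ?thesis .
  qed
  \<comment> \<open>The jet of \<open>wirtinger u\<close> up to order \<open>k\<close> is the jet of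
    \<open>u\<close> in orders 1 to \<open>Suc k\<close>.\<close>
  have shift: "(wirtinger ^^ i) (wirtinger u) z = (wirtinger ^^ i) (wirtinger v) z"
    if "\<And>j. j \<le> Suc k \<Longrightarrow> (wirtinger ^^ j) u z = (wirtinger ^^ j) v z" "i \<le> k" for u v i
    using that(1)[of "Suc i"] that(2) by (simp add: funpow_Suc_right del: funpow.simps)
  have "(wirtinger ^^ k) (\<lambda>w. f w * wirtinger g w) z = (wirtinger ^^ k) (\<lambda>w. f' w * wirtinger g' w) z"
    by (rule Suc.IH)
      (use Suc.prems lower shift[of f f'] shift[of g g'] in \<open>simp_all add: Ck_interior_wirtinger[OF assms(1)] del: Ck_interior.simps\<close>)
  moreover have "(wirtinger ^^ k) (\<lambda>w. wirtinger f w * g w) z = (wirtinger ^^ k) (\<lambda>w. wirtinger f' w * g' w) z"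
    by (rule Suc.IH)
      (use Suc.prems lower shift[of f f'] shift[of g g'] in \<open>simp_all add: Ck_interior_wirtinger[OF assms(1)] del: Ck_interior.simps\<close>)
  ultimately show ?case
    using expand[OF Suc.prems(1,2)] expand[OF Suc.prems(3,4)] by simp
qed

section \<open>The functional calculus\<close>

lemma order_min_poly_le:
  assumes "A \<in> carrier_mat n n"
  shows "Polynomial.order \<mu> (min_poly A) \<le> n"
  using order_degree[OF min_poly_nonzero[OF assms], of \<mu>] degree_min_poly_le_dim[OF assms] by simp

text \<open>Each root of the minimal polynomial is an eigenvalue, so a ball around it lies in
  \<open>\<Omega>\<close>. Its order is at most \<open>n\<close>, so the class on
  \<open>\<Omega>\<close> restricts to the one required on the ball.\<close>

lemma matrix_fun_definedI:
  assumes A: "A \<in> carrier_mat n n" and "open \<Omega>" "spectrum A \<subseteq> \<Omega>" and \<phi>: "\<phi> \<in> Ck_closure (n - 1) \<Omega>"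
  shows "matrix_fun_defined \<phi> A"
  unfolding matrix_fun_defined_def
proof (intro allI impI)
  fix \<mu> assume "poly (min_poly A) \<mu> = 0"
  then have "\<mu> \<in> \<Omega>" using min_poly_root_spectrum[OF A] assms(3) by auto
  then obtain r where r: "r > 0" "ball \<mu> r \<subseteq> \<Omega>"
    using \<open>open \<Omega>\<close> unfolding open_contains_ball by blast
  have "continuous_on (closure (ball \<mu> r)) \<phi>"
    using \<phi> by (intro continuous_on_subset[OF _ closure_mono[OF r(2)]]) (simp add: Ck_closure_def)
  moreover have "Ck_interior (Polynomial.order \<mu> (min_poly A) - 1) (ball \<mu> r) \<phi>"
    by (rule Ck_interior_subset[OF Ck_interior_le[of "n - 1"]])
      (use \<phi> r order_min_poly_le[OF A, of \<mu>] in \<open>simp_all add: Ck_closure_def\<close>)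
  ultimately show "\<exists>r>0. \<phi> \<in> Ck_closure (Polynomial.order \<mu> (min_poly A) - 1) (ball \<mu> r)"
    using r(1) by (intro exI[of _ r]) (simp add: Ck_closure_def)
qed

text \<open>The two membership claims, combined with the first conjunct, show that
  \<open>matrix_fun_defined\<close> also holds for the linear combination and the product.\<close>

theorem corollary3p5:
  fixes A :: "complex mat" and n :: nat and \<Omega> :: "complex set"
  assumes "n \<ge> 1" and "A \<in> carrier_mat n n"
    and "open \<Omega>" and "spectrum A \<subseteq> \<Omega>"
  shows "(\<forall>\<phi> \<in> Ck_closure (n - 1) \<Omega>.
            matrix_fun_defined \<phi> A \<and> matrix_fun \<phi> A \<in> carrier_mat n n) \<and>
         (\<forall>\<phi> \<in> Ck_closure (n - 1) \<Omega>. \<forall>\<psi> \<in> Ck_closure (n - 1) \<Omega>. \<forall>\<alpha> \<beta> :: complex.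
            (\<lambda>z. \<alpha> * \<phi> z + \<beta> * \<psi> z) \<in> Ck_closure (n - 1) \<Omega> \<and>
            (\<lambda>z. \<phi> z * \<psi> z) \<in> Ck_closure (n - 1) \<Omega> \<and>
            matrix_fun (\<lambda>z. \<alpha> * \<phi> z + \<beta> * \<psi> z) A
              = \<alpha> \<cdot>\<^sub>m matrix_fun \<phi> A + \<beta> \<cdot>\<^sub>m matrix_fun \<psi> A \<and>
            matrix_fun (\<lambda>z. \<phi> z * \<psi> z) A = matrix_fun \<phi> A * matrix_fun \<psi> A)"
proof (intro conjI ballI allI)
  note A = assms(2)
  let ?m = "min_poly A"
  fix \<phi> assume \<phi>: "\<phi> \<in> Ck_closure (n - 1) \<Omega>"
  show "matrix_fun_defined \<phi> A" by (rule matrix_fun_definedI[OF A assms(3,4) \<phi>])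
  show "matrix_fun \<phi> A \<in> carrier_mat n n" using A by (simp add: matrix_fun_def)
  fix \<psi> \<alpha> \<beta> assume \<psi>: "\<psi> \<in> Ck_closure (n - 1) \<Omega>"
  show "(\<lambda>z. \<alpha> * \<phi> z + \<beta> * \<psi> z) \<in> Ck_closure (n - 1) \<Omega>" "(\<lambda>z. \<phi> z * \<psi> z) \<in> Ck_closure (n - 1) \<Omega>"
    using \<phi> \<psi> assms(3) by (simp_all only: Ck_closure_lincomb Ck_closure_mult)
  \<comment> \<open>No degree bound is imposed on \<open>p\<close> and \<open>q\<close>, so that
    \<open>p * q\<close> can serve as an interpolant of the product.\<close>
  obtain p where p: "\<And>\<mu> \<nu>. \<nu> < Polynomial.order \<mu> ?m \<Longrightarrow> poly ((pderiv ^^ \<nu>) p) \<mu> = (wirtinger ^^ \<nu>) \<phi> \<mu>"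
    using hermite_interpolation_exists[OF min_poly_nonzero[OF A], of "\<lambda>\<mu> \<nu>. (wirtinger ^^ \<nu>) \<phi> \<mu>"] by blast
  obtain q where q: "\<And>\<mu> \<nu>. \<nu> < Polynomial.order \<mu> ?m \<Longrightarrow> poly ((pderiv ^^ \<nu>) q) \<mu> = (wirtinger ^^ \<nu>) \<psi> \<mu>"
    using hermite_interpolation_exists[OF min_poly_nonzero[OF A], of "\<lambda>\<mu> \<nu>. (wirtinger ^^ \<nu>) \<psi> \<mu>"] by blast
  note eq = matrix_fun_eq_poly_mat[OF A assms(1)]
  have Ck: "Ck_interior \<nu> \<Omega> \<phi>" "Ck_interior \<nu> \<Omega> \<psi>" if "\<nu> < Polynomial.order \<mu> ?m" for \<mu> \<nu>
  proof -
    have "\<nu> \<le> n - 1" using that order_min_poly_le[OF A, of \<mu>] by simp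
    then show "Ck_interior \<nu> \<Omega> \<phi>" "Ck_interior \<nu> \<Omega> \<psi>"
      using \<phi> \<psi> Ck_interior_le[OF _ \<open>\<nu> \<le> n - 1\<close>] unfolding Ck_closure_def by blast+
  qed
  have \<Omega>: "\<mu> \<in> \<Omega>" if "poly ?m \<mu> = 0" for \<mu>
    using min_poly_root_spectrum[OF A that] assms(4) by auto
  have p': "matrix_fun \<phi> A = poly_mat p A" and q': "matrix_fun \<psi> A = poly_mat q A"
    by (rule eq, erule p, rule eq, erule q)
  have "matrix_fun (\<lambda>z. \<alpha> * \<phi> z + \<beta> * \<psi> z) A = poly_mat (Polynomial.smult \<alpha> p + Polynomial.smult \<beta> q) A"
  proof (rule eq)
    fix \<mu> \<nu> assume \<mu>: "poly ?m \<mu> = 0" and \<nu>: "\<nu> < Polynomial.order \<mu> ?m"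
    show "poly ((pderiv ^^ \<nu>) (Polynomial.smult \<alpha> p + Polynomial.smult \<beta> q)) \<mu>
        = (wirtinger ^^ \<nu>) (\<lambda>z. \<alpha> * \<phi> z + \<beta> * \<psi> z) \<mu>"
      using wirtinger_funpow_lincomb[OF assms(3) Ck[OF \<nu>] \<Omega>[OF \<mu>]] p[OF \<nu>] q[OF \<nu>]
      by (simp add: higher_pderiv_add higher_pderiv_smult)
  qed
  then show "matrix_fun (\<lambda>z. \<alpha> * \<phi> z + \<beta> * \<psi> z) A = \<alpha> \<cdot>\<^sub>m matrix_fun \<phi> A + \<beta> \<cdot>\<^sub>m matrix_fun \<psi> A"
    by (simp add: p' q' poly_mat_add[OF A] poly_mat_smult[OF A])
  have "matrix_fun (\<lambda>z. \<phi> z * \<psi> z) A = poly_mat (p * q) A"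
  proof (rule eq)
    fix \<mu> \<nu> assume \<mu>: "poly ?m \<mu> = 0" and \<nu>: "\<nu> < Polynomial.order \<mu> ?m"
    \<comment> \<open>The formal derivatives of \<open>p * q\<close> are read as Wirtinger
      derivatives, so that \<open>wirtinger_jet_mult\<close> can compare the polynomial factors with
      \<open>\<phi>\<close> and \<open>\<psi>\<close>.\<close>
    have "(wirtinger ^^ \<nu>) (poly (p * q)) \<mu> = (wirtinger ^^ \<nu>) (\<lambda>z. poly p z * poly q z) \<mu>"
      by (intro arg_cong[where f = "\<lambda>f. (wirtinger ^^ \<nu>) f \<mu>"] ext) (rule poly_mult)
    also have "\<dots> = (wirtinger ^^ \<nu>) (\<lambda>z. \<phi> z * \<psi> z) \<mu>"
      by (rule wirtinger_jet_mult[OF assms(3) \<Omega>[OF \<mu>]])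
        (use Ck[OF \<nu>] \<nu> in \<open>simp_all add: Ck_interior_poly wirtinger_funpow_poly p q\<close>)
    finally show "poly ((pderiv ^^ \<nu>) (p * q)) \<mu> = (wirtinger ^^ \<nu>) (\<lambda>z. \<phi> z * \<psi> z) \<mu>"
      by (simp only: wirtinger_funpow_poly)
  qed
  then show "matrix_fun (\<lambda>z. \<phi> z * \<psi> z) A = matrix_fun \<phi> A * matrix_fun \<psi> A"
    by (simp add: p' q' poly_mat_mult[OF A])
qed

end
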